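(* For every $n \in \mathbb{N}$, the space $\mathrm{TYPE}[n]$ is homeomorphic to the Stone–Čech compactification $\beta\mathbb{N}$ of the discrete space $\mathbb{N}$.
   Context: $2^{\mathcal{P}(\mathbb{N})}$ is the set $\mathcal{P}(\mathcal{P}(\mathbb{N}))$ of all families of subsets of $\mathbb{N}$ with the product topology ($2=\{0,1\}$ discrete), and $Top(\mathbb{N}) \subseteq 2^{\mathcal{P}(\mathbb{N})}$ is the set of all topologies on $\mathbb{N}$ with the subspace topology. An ultratopology on a set $X$ is a topology of the form $\mathcal{P}(X \smallsetminus \{x\}) \cup \mathcal{U}$, where $x\in X$ and $\mathcal{U}$ is an ultrafilter on $X$ (principal or non-principal) with $\{x\} \notin \mathcal{U}$. For $n \in \mathbb{N}$, $\mathrm{TYPE}[n]$ is the set of all ultratopologies $\mathcal{T}$ on $\mathbb{N}$ with $\{n\} \notin \mathcal{T}$, with the subspace topology from $Top(\mathbb{N})$. *)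

theory Defs
  imports "HOL-Analysis.Analysis"
begin

text \<open>The power \<open>2\<^sup>I\<close>, with \<open>I\<close> the universe of the type \<open>'i\<close>: its points are subsets of \<open>I\<close>,
  identified with their characteristic functions, and it carries the product topology.\<close>

definition two_power :: "'i set topology" where
  "two_power =
     pullback_topology UNIV (\<lambda>S i. i \<in> S) (product_topology (\<lambda>_. discrete_topology (UNIV :: bool set)) UNIV)"

text \<open>A topology on \<open>X\<close> is represented by its family of open sets, i.e. as a point of \<open>2\<^sup>\<P>\<^sup>(\<^sup>X\<^sup>)\<close>.\<close>

definition topologies_on :: "'a set \<Rightarrow> 'a set set set" where
  "topologies_on X = {{S. openin t S} | t. topspace t = X}"

definition Top_space :: "'a set set topology" where
  "Top_space = subtopology two_power (topologies_on UNIV)"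

definition filter_on :: "'a set \<Rightarrow> 'a set set \<Rightarrow> bool" where
  "filter_on X \<F> \<longleftrightarrow> \<F> \<subseteq> Pow X \<and> X \<in> \<F> \<and> {} \<notin> \<F> \<and>
     (\<forall>A\<in>\<F>. \<forall>B\<in>\<F>. A \<inter> B \<in> \<F>) \<and> (\<forall>A\<in>\<F>. \<forall>B. A \<subseteq> B \<and> B \<subseteq> X \<longrightarrow> B \<in> \<F>)"

definition ultrafilter_on :: "'a set \<Rightarrow> 'a set set \<Rightarrow> bool" where
  "ultrafilter_on X \<U> \<longleftrightarrow> filter_on X \<U> \<and> (\<forall>A. A \<subseteq> X \<longrightarrow> A \<in> \<U> \<or> X - A \<in> \<U>)"

definition ultratopology_on :: "'a set \<Rightarrow> 'a set set \<Rightarrow> bool" where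
  "ultratopology_on X \<T> \<longleftrightarrow> \<T> \<in> topologies_on X \<and>
     (\<exists>x\<in>X. \<exists>\<U>. ultrafilter_on X \<U> \<and> {x} \<notin> \<U> \<and> \<T> = Pow (X - {x}) \<union> \<U>)"

definition TYPE_set :: "nat \<Rightarrow> nat set set set" where
  "TYPE_set n = {\<T>. ultratopology_on UNIV \<T> \<and> {n} \<notin> \<T>}"

definition TYPE_space :: "nat \<Rightarrow> nat set set topology" where
  "TYPE_space n = subtopology Top_space (TYPE_set n)"

text \<open>The Stone--Cech compactification of \<open>X\<close>: the closure of the image of \<open>X\<close> under the evaluation map
  into the cube \<open>[0,1]\<^sup>C\<close>, where \<open>C\<close> is the set of continuous functions from \<open>X\<close> to \<open>[0,1]\<close>. These
  are taken to be extensional, so that each of them is represented by exactly one function on the type.\<close>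

definition unit_functions :: "'a topology \<Rightarrow> ('a \<Rightarrow> real) set" where
  "unit_functions X =
     {f \<in> extensional (topspace X). continuous_map X (top_of_set {0..1}) f}"

definition unit_cube :: "'a topology \<Rightarrow> (('a \<Rightarrow> real) \<Rightarrow> real) topology" where
  "unit_cube X = product_topology (\<lambda>_. top_of_set {0..1}) (unit_functions X)"

definition evaluation :: "'a topology \<Rightarrow> 'a \<Rightarrow> ('a \<Rightarrow> real) \<Rightarrow> real" where
  "evaluation X x = (\<lambda>f\<in>unit_functions X. f x)"

definition stone_cech :: "'a topology \<Rightarrow> (('a \<Rightarrow> real) \<Rightarrow> real) topology" where
  "stone_cech X =
     subtopology (unit_cube X) (unit_cube X closure_of (evaluation X ` topspace X))"

end

theory Submission
  imports Defs
begin

text \<open>A topology in \<open>TYPE[n]\<close> is the same thing as an ultrafilter on \<open>\<nat>\<close> other than the principal one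
  at \<open>n\<close>, that is, an ultrafilter on \<open>\<nat> - {n}\<close>, and the ultrafilters on a countably infinite set,
  topologized by their membership relations, form \<open>\<beta>\<nat>\<close>.

  To make this precise, view a point \<open>p\<close> of \<open>\<beta>\<nat>\<close> as a function that assigns a number in \<open>[0,1]\<close>
  to each \<open>f : \<nat> \<rightarrow> [0,1]\<close>. Every closed relation between finitely many of these numbers that
  holds for the evaluations at points of \<open>\<nat>\<close> holds for \<open>p\<close>, by density (\<open>stone_cech_closed_relation\<close>).
  Applied to indicator functions, this shows that the sets \<open>A\<close> with \<open>p 1\<^sub>A = 1\<close> form an ultrafilter
  (\<open>ultrafilter_on_large_sets\<close>); applied to sublevel sets, that this ultrafilter determines
  \<open>p\<close> (\<open>inj_on_large_sets\<close>). By compactness every ultrafilter, seen as a filter base, is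
  obtained (\<open>ex_large_sets_superset\<close>, together with the maximality of ultrafilters).

  Fix a bijection \<open>e\<close> from \<open>\<nat>\<close> to \<open>\<nat> - {n}\<close>. Pushing the ultrafilter of \<open>p\<close> forward along \<open>e\<close> and
  adding \<open>\<P>(\<nat> - {n})\<close> gives a bijection from \<open>\<beta>\<nat>\<close> onto \<open>TYPE[n]\<close>. It is continuous, since
  \<open>p \<mapsto> p 1\<^sub>A\<close> is continuous with values in \<open>{0,1}\<close>, and a continuous bijection from a compact
  space to a Hausdorff space is a homeomorphism.\<close>

section \<open>Powers of the two-point space\<close>

lemma topspace_two_power [simp]: "topspace two_power = UNIV"
  by (simp add: two_power_def topspace_pullback_topology)

lemma Hausdorff_two_power: "Hausdorff_space (two_power :: 'i set topology)"
proof (rule Hausdorff_space_injective_preimage)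
  let ?P = "product_topology (\<lambda>_::'i. discrete_topology (UNIV :: bool set)) UNIV"
  show "Hausdorff_space ?P"
    by (simp add: Hausdorff_space_product_topology Hausdorff_space_discrete_topology)
  show "continuous_map two_power ?P (\<lambda>S i. i \<in> S)"
    unfolding two_power_def
    using continuous_map_pullback[OF continuous_map_id, where f = "\<lambda>S i. i \<in> S"]
    by simp
  show "inj_on (\<lambda>S i. i \<in> S) (topspace (two_power :: 'i set topology))"
    by (auto simp: inj_on_def fun_eq_iff)
qed

lemma continuous_map_two_power:
  assumes "\<And>i. continuous_map X (discrete_topology UNIV) (\<lambda>x. i \<in> f x)"
  shows "continuous_map X two_power f"
  unfolding two_power_def
  by (rule continuous_map_pullback')
     (use assms in \<open>auto simp: o_def continuous_map_componentwise_UNIV\<close>)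

lemma continuous_map_bool_of_01_valued:
  fixes g :: "'a \<Rightarrow> real"
  assumes g: "continuous_map X euclidean g" and val: "\<And>x. x \<in> topspace X \<Longrightarrow> g x \<in> {0, 1}"
  shows "continuous_map X (discrete_topology UNIV) (\<lambda>x. g x = 1)"
proof -
  have "openin X {x \<in> topspace X. (g x = 1) \<in> B}" for B
  proof -
    \<comment> \<open>Any cut between the two values turns preimages of truth values into preimages of half-lines.\<close>
    have "{x \<in> topspace X. (g x = 1) \<in> B} = {x \<in> topspace X. g x \<in>
        (if True \<in> B then {1/2<..} else {}) \<union> (if False \<in> B then {..<1/2} else {})}"
      using val by (fastforce split: if_splits)
    also have "openin X \<dots>"
      by (rule openin_continuous_map_preimage[OF g]) (auto simp: open_Un)
    finally show ?thesis .
  qed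
  then show ?thesis
    by (auto simp: continuous_map_def)
qed

section \<open>Points of the Stone-Cech compactification\<close>

lemma compact_stone_cech: "compact_space (stone_cech X)"
proof -
  have "compact_space (unit_cube X)"
    unfolding unit_cube_def by (simp add: compact_space_product_topology compact_space_subtopology)
  then have "compactin (unit_cube X) (unit_cube X closure_of (evaluation X ` topspace X))"
    by (rule closedin_compact_space) simp
  then show ?thesis
    unfolding stone_cech_def by (rule compact_space_subtopology)
qed

lemma evaluation_in_unit_cube:
  "x \<in> topspace X \<Longrightarrow> evaluation X x \<in> topspace (unit_cube X)"
  by (auto simp: evaluation_def unit_cube_def unit_functions_def continuous_map_in_subtopology)

lemma evaluation_in_stone_cech:
  "x \<in> topspace X \<Longrightarrow> evaluation X x \<in> topspace (stone_cech X)"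
  using closure_of_subset[of "evaluation X ` topspace X" "unit_cube X"] evaluation_in_unit_cube[of _ X]
  by (auto simp: stone_cech_def topspace_subtopology)

lemma continuous_map_unit_cube_coordinate:
  assumes "f \<in> unit_functions X"
  shows "continuous_map (unit_cube X) euclidean (\<lambda>p. p f)"
  using continuous_map_product_projection[OF assms, of "\<lambda>_. top_of_set {0..1::real}"]
  unfolding unit_cube_def by (rule continuous_map_into_fulltopology)

lemma continuous_map_stone_cech_coordinate:
  "f \<in> unit_functions X \<Longrightarrow> continuous_map (stone_cech X) euclidean (\<lambda>p. p f)"
  unfolding stone_cech_def
  by (intro continuous_map_from_subtopology continuous_map_unit_cube_coordinate)

lemma stone_cech_closed_relation:
  assumes p: "p \<in> topspace (stone_cech X)" and g: "continuous_map (unit_cube X) euclidean g"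
    and C: "closed C" and ev: "\<And>x. x \<in> topspace X \<Longrightarrow> g (evaluation X x) \<in> C"
  shows "g p \<in> C"
proof -
  have "closedin (unit_cube X) {q \<in> topspace (unit_cube X). g q \<in> C}"
    by (rule closedin_continuous_map_preimage[OF g]) (use C in simp)
  then have "unit_cube X closure_of (evaluation X ` topspace X)
      \<subseteq> {q \<in> topspace (unit_cube X). g q \<in> C}"
    by (intro closure_of_minimal) (use ev evaluation_in_unit_cube[of _ X] in auto)
  then show ?thesis
    using p by (auto simp: stone_cech_def)
qed

abbreviation beta :: "(('a \<Rightarrow> real) \<Rightarrow> real) topology" where
  "beta \<equiv> stone_cech (discrete_topology (UNIV :: 'a set))"

abbreviation ev :: "'a \<Rightarrow> ('a \<Rightarrow> real) \<Rightarrow> real" where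
  "ev \<equiv> evaluation (discrete_topology (UNIV :: 'a set))"

lemma unit_functions_discrete:
  "unit_functions (discrete_topology (UNIV :: 'a set)) = {f. \<forall>x. f x \<in> {0..1}}"
  by (auto simp: unit_functions_def)

lemma indicator_in_unit_functions [simp]:
  "indicat_real A \<in> unit_functions (discrete_topology UNIV)"
  by (auto simp: unit_functions_discrete indicator_def)

lemma ev_apply: "f \<in> unit_functions (discrete_topology UNIV) \<Longrightarrow> ev x f = f x"
  by (simp add: evaluation_def)

lemmas continuous_coordinate = continuous_map_unit_cube_coordinate[of _ "discrete_topology UNIV"]

section \<open>The ultrafilter of a point\<close>

definition large_sets :: "(('a \<Rightarrow> real) \<Rightarrow> real) \<Rightarrow> 'a set set" where
  "large_sets p = {A. p (indicat_real A) = 1}"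

lemma beta_indicator_01:
  assumes "p \<in> topspace beta"
  shows "p (indicat_real A) \<in> {0, 1}"
  using assms
  by (rule stone_cech_closed_relation[where g = "\<lambda>p. p (indicat_real A)"])
     (auto intro!: continuous_coordinate simp: ev_apply indicator_def)

text \<open>Each filter axiom is an equation or inequality between the values at indicator functions
  that holds at all evaluations.\<close>

lemma ultrafilter_on_large_sets:
  assumes p: "p \<in> topspace beta"
  shows "ultrafilter_on UNIV (large_sets p)"
proof -
  have univ: "p (indicat_real UNIV) \<in> {1}"
    by (rule stone_cech_closed_relation[OF p, where g = "\<lambda>p. p (indicat_real UNIV)"])
       (auto intro!: continuous_coordinate simp: ev_apply simp del: indicator_UNIV)
  have empty: "p (indicat_real {}) \<in> {0}"
    by (rule stone_cech_closed_relation[OF p, where g = "\<lambda>p. p (indicat_real {})"])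
       (auto intro!: continuous_coordinate simp: ev_apply)
  have compl: "p (indicat_real A) + p (indicat_real (UNIV - A)) \<in> {1}" for A
    by (rule stone_cech_closed_relation[OF p,
          where g = "\<lambda>p. p (indicat_real A) + p (indicat_real (UNIV - A))"])
       (auto intro!: continuous_coordinate continuous_map_add simp: ev_apply indicator_def)
  have mono: "p (indicat_real B) - p (indicat_real A) \<in> {0..}" if "A \<subseteq> B" for A B
    by (rule stone_cech_closed_relation[OF p,
          where g = "\<lambda>p. p (indicat_real B) - p (indicat_real A)"])
       (use that in \<open>auto intro!: continuous_coordinate continuous_map_diff
          simp: ev_apply indicator_def\<close>)
  have inter: "p (indicat_real A) * p (indicat_real B) - p (indicat_real (A \<inter> B)) \<in> {0}" for A B
    by (rule stone_cech_closed_relation[OF p,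
          where g = "\<lambda>p. p (indicat_real A) * p (indicat_real B) - p (indicat_real (A \<inter> B))"])
       (auto intro!: continuous_coordinate continuous_map_diff continuous_map_real_mult
          simp: ev_apply indicator_def)
  have "B \<in> large_sets p" if "A \<in> large_sets p" "A \<subseteq> B" for A B
    using mono[OF that(2)] beta_indicator_01[OF p, of B] that(1) by (auto simp: large_sets_def)
  moreover have "A \<inter> B \<in> large_sets p" if "A \<in> large_sets p" "B \<in> large_sets p" for A B
    using inter[of A B] that by (simp add: large_sets_def)
  moreover have "A \<in> large_sets p \<or> UNIV - A \<in> large_sets p" for A
    using compl[of A] beta_indicator_01[OF p, of A] by (auto simp: large_sets_def)
  moreover have "UNIV \<in> large_sets p" "{} \<notin> large_sets p"
    using univ empty by (auto simp: large_sets_def)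
  ultimately show ?thesis
    unfolding ultrafilter_on_def filter_on_def by blast
qed

text \<open>A point \<open>p\<close> sees a sublevel set of \<open>f\<close> as large or small according to the position of
  \<open>p f\<close> relative to the level, so the large sets determine every value \<open>p f\<close>.\<close>

lemma sublevel_set_large:
  assumes p: "p \<in> topspace beta" and f: "f \<in> unit_functions (discrete_topology UNIV)"
  shows "p f < c \<Longrightarrow> {x. f x < c} \<in> large_sets p" "c < p f \<Longrightarrow> {x. f x < c} \<notin> large_sets p"
proof -
  let ?A = "{x. f x < c}"
  have "max (c - p f) 0 * (1 - p (indicat_real ?A)) \<in> {0}"
    by (rule stone_cech_closed_relation[OF p,
          where g = "\<lambda>p. max (c - p f) 0 * (1 - p (indicat_real ?A))"])
       (use f in \<open>auto intro!: continuous_coordinate continuous_map_diff continuous_map_real_mult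
          continuous_map_real_max simp: ev_apply indicator_def\<close>)
  then show "p f < c \<Longrightarrow> ?A \<in> large_sets p"
    by (auto simp: large_sets_def)
  have "max (p f - c) 0 * p (indicat_real ?A) \<in> {0}"
    by (rule stone_cech_closed_relation[OF p,
          where g = "\<lambda>p. max (p f - c) 0 * p (indicat_real ?A)"])
       (use f in \<open>auto intro!: continuous_coordinate continuous_map_diff continuous_map_real_mult
          continuous_map_real_max simp: ev_apply indicator_def\<close>)
  then show "c < p f \<Longrightarrow> ?A \<notin> large_sets p"
    by (auto simp: large_sets_def)
qed

lemma inj_on_large_sets: "inj_on large_sets (topspace beta)"
proof (rule inj_onI)
  fix p q :: "('a \<Rightarrow> real) \<Rightarrow> real"
  let ?U = "unit_functions (discrete_topology (UNIV :: 'a set))"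
  assume p: "p \<in> topspace beta" and q: "q \<in> topspace beta" and eq: "large_sets p = large_sets q"
  have less: False
    if "p f < q f" "p \<in> topspace beta" "q \<in> topspace beta" "large_sets p = large_sets q" "f \<in> ?U"
    for p q :: "('a \<Rightarrow> real) \<Rightarrow> real" and f
    using sublevel_set_large[of _ f] dense[OF that(1)] that by metis
  have "p \<in> extensional ?U" "q \<in> extensional ?U"
    using p q closure_of_subset_topspace[of "unit_cube (discrete_topology (UNIV :: 'a set))"]
    by (fastforce simp: stone_cech_def unit_cube_def PiE_def)+
  then show "p = q"
  proof (rule extensionalityI)
    fix f assume "f \<in> ?U"
    then show "p f = q f"
      using less[of p f q] less[of q f p] p q eq by fastforce
  qed
qed

text \<open>The points at which a given set is large form a closed set. Those closed sets inherit the finite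
  intersection property from \<open>\<B>\<close>, since evaluation at a common point of finitely many members of
  \<open>\<B>\<close> lies in all of the corresponding ones; so compactness applies.\<close>

lemma ex_large_sets_superset:
  fixes \<B> :: "'a set set"
  assumes fip: "\<And>\<F>. finite \<F> \<Longrightarrow> \<F> \<subseteq> \<B> \<Longrightarrow> \<Inter>\<F> \<noteq> {}"
  obtains p where "p \<in> topspace beta" "\<B> \<subseteq> large_sets p"
proof -
  define K :: "'a set \<Rightarrow> (('a \<Rightarrow> real) \<Rightarrow> real) set"
    where "K A = {p \<in> topspace beta. p (indicat_real A) \<in> {1}}" for A
  have closed: "closedin beta (K A)" for A
    unfolding K_def
    by (rule closedin_continuous_map_preimage[where Y = euclidean])
       (auto intro!: continuous_map_stone_cech_coordinate)
  \<comment> \<open>Taking \<open>UNIV\<close> along keeps the intersection inside the space when \<open>\<B>\<close> is empty.\<close>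
  have "\<Inter>(K ` insert UNIV \<B>) \<noteq> {}"
  proof (rule compact_space_fip[THEN iffD1, OF compact_stone_cech, rule_format])
    have "\<Inter>\<F> \<noteq> {}" if \<F>: "finite \<F>" "\<F> \<subseteq> K ` insert UNIV \<B>" for \<F>
    proof -
      obtain \<A> where \<A>: "finite \<A>" "\<A> \<subseteq> insert UNIV \<B>" "\<F> = K ` \<A>"
        using finite_subset_image[OF \<F>] by blast
      have "\<Inter>(\<A> - {UNIV}) \<noteq> {}"
        using \<A>(1,2) by (intro fip) auto
      then obtain x where "\<And>A. A \<in> \<A> \<Longrightarrow> x \<in> A"
        by blast
      then have "ev x \<in> \<Inter>\<F>"
        unfolding \<A>(3) by (auto simp: K_def ev_apply evaluation_in_stone_cech)
      then show ?thesis
        by blast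
    qed
    then show "(\<forall>C\<in>K ` insert UNIV \<B>. closedin beta C) \<and>
        (\<forall>\<F>. finite \<F> \<and> \<F> \<subseteq> K ` insert UNIV \<B> \<longrightarrow> \<Inter>\<F> \<noteq> {})"
      using closed by blast
  qed
  then obtain p where "\<And>A. A \<in> insert UNIV \<B> \<Longrightarrow> p \<in> K A"
    by blast
  then show thesis
    using that[of p] by (auto simp: K_def large_sets_def)
qed

section \<open>Ultrafilters and ultratopologies\<close>

lemma filter_on_Inter:
  assumes "filter_on UNIV \<U>" "finite \<G>" "\<G> \<subseteq> \<U>"
  shows "\<Inter>\<G> \<in> \<U>"
  using assms(2,3)
proof (induction \<G>)
  case empty
  then show ?case
    using assms(1) by (simp add: filter_on_def)
next
  case (insert A \<G>)
  then show ?case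
    using assms(1) by (simp add: filter_on_def)
qed

lemma ultrafilter_on_maximal:
  assumes "ultrafilter_on X \<U>" "filter_on X \<W>" "\<U> \<subseteq> \<W>"
  shows "\<U> = \<W>"
proof -
  have W: "\<W> \<subseteq> Pow X" "{} \<notin> \<W>" "\<And>A B. A \<in> \<W> \<Longrightarrow> B \<in> \<W> \<Longrightarrow> A \<inter> B \<in> \<W>"
    using assms(2) by (auto simp: filter_on_def)
  have "A \<in> \<U>" if "A \<in> \<W>" for A
  proof (rule ccontr)
    assume "A \<notin> \<U>"
    moreover have "A \<subseteq> X"
      using W(1) that by blast
    ultimately have "X - A \<in> \<U>"
      using assms(1) by (auto simp: ultrafilter_on_def)
    then have "A \<inter> (X - A) \<in> \<W>"
      using assms(3) that by (intro W(3)) auto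
    then show False
      using W(2) by simp
  qed
  then show ?thesis
    using assms(3) by blast
qed

lemma ultrafilter_on_pushforward:
  assumes "ultrafilter_on UNIV \<U>"
  shows "ultrafilter_on UNIV {S. f -` S \<in> \<U>}"
proof -
  have U: "UNIV \<in> \<U>" "{} \<notin> \<U>" "\<And>A B. A \<in> \<U> \<Longrightarrow> B \<in> \<U> \<Longrightarrow> A \<inter> B \<in> \<U>"
      "\<And>A B. A \<in> \<U> \<Longrightarrow> A \<subseteq> B \<Longrightarrow> B \<in> \<U>" "\<And>A. A \<in> \<U> \<or> UNIV - A \<in> \<U>"
    using assms unfolding ultrafilter_on_def filter_on_def by auto
  have "f -` T \<in> \<U>" if "f -` S \<in> \<U>" "S \<subseteq> T" for S T
    using U(4)[OF that(1) vimage_mono[OF that(2)]] .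
  moreover have "f -` S \<in> \<U> \<or> f -` (UNIV - S) \<in> \<U>" for S
    using U(5)[of "f -` S"] by (simp add: vimage_Diff)
  ultimately show ?thesis
    using U(1-3) by (simp add: ultrafilter_on_def filter_on_def)
qed

lemma Pow_Un_filter_topology:
  assumes "filter_on X \<U>"
  shows "Pow (X - {x}) \<union> \<U> \<in> topologies_on X"
proof -
  let ?T = "Pow (X - {x}) \<union> \<U>"
  have F: "\<U> \<subseteq> Pow X" "X \<in> \<U>" "\<And>A B. A \<in> \<U> \<Longrightarrow> B \<in> \<U> \<Longrightarrow> A \<inter> B \<in> \<U>"
      "\<And>A B. A \<in> \<U> \<Longrightarrow> A \<subseteq> B \<Longrightarrow> B \<subseteq> X \<Longrightarrow> B \<in> \<U>"
    using assms by (auto simp: filter_on_def)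
  have "istopology (\<lambda>S. S \<in> ?T)"
    unfolding istopology_def
  proof (intro conjI allI impI)
    fix S T assume "S \<in> ?T" "T \<in> ?T"
    then show "S \<inter> T \<in> ?T"
      using F(1,3) by blast
  next
    fix \<K> assume \<K>: "\<forall>K\<in>\<K>. K \<in> ?T"
    then have sub: "\<Union>\<K> \<subseteq> X"
      using F(1) by blast
    show "\<Union>\<K> \<in> ?T"
    proof (cases "x \<in> \<Union>\<K>")
      case True
      then obtain K where "K \<in> \<K>" "K \<in> \<U>"
        using \<K> by blast
      then show ?thesis
        using F(4)[of K "\<Union>\<K>"] sub by blast
    qed (use sub in blast)
  qed
  then have op: "openin (topology (\<lambda>S. S \<in> ?T)) = (\<lambda>S. S \<in> ?T)"
    by (rule topology_inverse')
  then have "topspace (topology (\<lambda>S. S \<in> ?T)) = X"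
    using F(1,2) by (auto simp: topspace_def)
  moreover have "{S. openin (topology (\<lambda>S. S \<in> ?T)) S} = ?T"
    unfolding op by (rule Collect_mem_eq)
  ultimately show ?thesis
    unfolding topologies_on_def by blast
qed

text \<open>If the distinguished point of an ultratopology is some \<open>x \<noteq> n\<close>, then \<open>{n}\<close> is open because it
  lies in \<open>\<P>(\<nat> - {x})\<close>. So \<open>{n} \<notin> \<T>\<close> forces the distinguished point to be \<open>n\<close>.\<close>

lemma TYPE_set_eq:
  "TYPE_set n = {Pow (UNIV - {n}) \<union> \<U> | \<U>. ultrafilter_on UNIV \<U> \<and> {n} \<notin> \<U>}"
proof (intro equalityI subsetI)
  fix \<T> assume "\<T> \<in> TYPE_set n"
  then obtain x \<U> where \<T>: "\<T> = Pow (UNIV - {x}) \<union> \<U>" "{n} \<notin> \<T>"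
      and \<U>: "ultrafilter_on UNIV \<U>"
    by (auto simp: TYPE_set_def ultratopology_on_def)
  then have "x = n"
    by auto
  then show "\<T> \<in> {Pow (UNIV - {n}) \<union> \<U> | \<U>. ultrafilter_on UNIV \<U> \<and> {n} \<notin> \<U>}"
    using \<T> \<U> by blast
next
  fix \<T> assume "\<T> \<in> {Pow (UNIV - {n}) \<union> \<U> | \<U>. ultrafilter_on UNIV \<U> \<and> {n} \<notin> \<U>}"
  then obtain \<U> where "\<T> = Pow (UNIV - {n}) \<union> \<U>" "ultrafilter_on UNIV \<U>" "{n} \<notin> \<U>"
    by blast
  then show "\<T> \<in> TYPE_set n"
    using Pow_Un_filter_topology[of UNIV \<U> n]
    by (auto simp: TYPE_set_def ultratopology_on_def ultrafilter_on_def)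
qed

lemma TYPE_space_eq: "TYPE_space n = subtopology two_power (TYPE_set n)"
proof -
  have "TYPE_set n \<subseteq> topologies_on UNIV"
    by (auto simp: TYPE_set_def ultratopology_on_def)
  then show ?thesis
    by (simp add: TYPE_space_def Top_space_def subtopology_subtopology Int_absorb1)
qed

section \<open>The homeomorphism\<close>

text \<open>Here \<open>e\<close> stands for an enumeration of \<open>\<nat> - {n}\<close>: pushing the large sets forward along \<open>e\<close>
  removes exactly the principal ultrafilter at \<open>n\<close> from the possible results.\<close>

definition ultratopology_of_point ::
    "nat \<Rightarrow> (nat \<Rightarrow> nat) \<Rightarrow> ((nat \<Rightarrow> real) \<Rightarrow> real) \<Rightarrow> nat set set" where
  "ultratopology_of_point n e p = Pow (UNIV - {n}) \<union> {S. e -` S \<in> large_sets p}"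

lemma continuous_ultratopology_of_point:
  "continuous_map beta two_power (ultratopology_of_point n e)"
proof (rule continuous_map_two_power)
  fix S
  have eq: "(\<lambda>p. S \<in> ultratopology_of_point n e p) =
      (if n \<in> S then (\<lambda>p. p (indicat_real (e -` S)) = 1) else (\<lambda>_. True))"
    by (auto simp: ultratopology_of_point_def large_sets_def fun_eq_iff)
  show "continuous_map beta (discrete_topology UNIV) (\<lambda>p. S \<in> ultratopology_of_point n e p)"
    unfolding eq
    using beta_indicator_01[of _ "e -` S"]
    by (auto intro!: continuous_map_bool_of_01_valued continuous_map_stone_cech_coordinate)
qed

lemma ultratopology_of_point_in_TYPE_set:
  assumes "p \<in> topspace beta" "n \<notin> range e"
  shows "ultratopology_of_point n e p \<in> TYPE_set n"
proof -
  have U: "ultrafilter_on UNIV (large_sets p)"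
    by (rule ultrafilter_on_large_sets[OF assms(1)])
  have "e -` {n} = {}"
    using assms(2) by auto
  then have "{n} \<notin> {S. e -` S \<in> large_sets p}"
    using U by (simp add: ultrafilter_on_def filter_on_def)
  then show ?thesis
    using ultrafilter_on_pushforward[OF U, of e]
    unfolding TYPE_set_eq ultratopology_of_point_def by blast
qed

lemma inj_on_ultratopology_of_point:
  assumes "inj e" "n \<notin> range e"
  shows "inj_on (ultratopology_of_point n e) (topspace beta)"
proof (rule inj_onI)
  fix p q
  assume pq: "p \<in> topspace beta" "q \<in> topspace beta"
    and eq: "ultratopology_of_point n e p = ultratopology_of_point n e q"
  \<comment> \<open>Adding \<open>n\<close> to the image of \<open>A\<close> excludes the sets that are open for every \<open>p\<close>.\<close>
  have "insert n (e ` A) \<in> ultratopology_of_point n e r \<longleftrightarrow> A \<in> large_sets r" for A r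
  proof -
    have "e -` insert n (e ` A) = A"
      using assms by (auto simp: inj_def)
    then show ?thesis
      by (auto simp: ultratopology_of_point_def)
  qed
  then have "large_sets p = large_sets q"
    using eq by blast
  then show "p = q"
    using pq inj_on_large_sets by (auto dest: inj_onD)
qed

lemma TYPE_set_subset_image:
  assumes range_e: "range e = UNIV - {n}"
  shows "TYPE_set n \<subseteq> ultratopology_of_point n e ` topspace beta"
proof
  fix \<T> assume "\<T> \<in> TYPE_set n"
  then obtain \<U> where \<T>: "\<T> = Pow (UNIV - {n}) \<union> \<U>" and \<U>: "ultrafilter_on UNIV \<U>" "{n} \<notin> \<U>"
    unfolding TYPE_set_eq by blast
  have filter: "filter_on UNIV \<U>"
    using \<U>(1) by (simp add: ultrafilter_on_def)
  have "\<Inter>\<F> \<noteq> {}" if "finite \<F>" "\<F> \<subseteq> vimage e ` \<U>" for \<F>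
  proof -
    obtain \<G> where \<G>: "finite \<G>" "\<G> \<subseteq> \<U>" "\<F> = vimage e ` \<G>"
      using finite_subset_image[OF \<open>finite \<F>\<close> \<open>\<F> \<subseteq> vimage e ` \<U>\<close>] by blast
    \<comment> \<open>Since \<open>UNIV - {n}\<close> belongs to the ultrafilter, common points can be found in the range of \<open>e\<close>.\<close>
    have "UNIV - {n} \<in> \<U>"
      using \<U> by (auto simp: ultrafilter_on_def)
    then have "\<Inter>(insert (UNIV - {n}) \<G>) \<in> \<U>"
      using \<G> by (intro filter_on_Inter[OF filter]) auto
    then have "\<Inter>(insert (range e) \<G>) \<noteq> {}"
      using filter unfolding range_e filter_on_def by metis
    then show ?thesis
      unfolding \<G>(3) by blast
  qed
  then obtain p where p: "p \<in> topspace beta" "vimage e ` \<U> \<subseteq> large_sets p"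
    using ex_large_sets_superset by metis
  have "\<U> = {S. e -` S \<in> large_sets p}"
  proof (rule ultrafilter_on_maximal[OF \<U>(1)])
    show "filter_on UNIV {S. e -` S \<in> large_sets p}"
      using ultrafilter_on_pushforward[OF ultrafilter_on_large_sets[OF p(1)], of e]
      by (simp add: ultrafilter_on_def)
  qed (use p(2) in blast)
  then show "\<T> \<in> ultratopology_of_point n e ` topspace beta"
    using \<T> p(1) by (auto simp: ultratopology_of_point_def)
qed

theorem theorem6p3:
  fixes n :: nat
  shows "TYPE_space n homeomorphic_space stone_cech (discrete_topology (UNIV :: nat set))"
proof -
  define e where "e = from_nat_into (UNIV - {n})"
  have "bij_betw e UNIV (UNIV - {n})"
    unfolding e_def by (rule bij_betw_from_nat_into) (auto simp: infinite_UNIV_nat)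
  then have e: "inj e" "range e = UNIV - {n}" "n \<notin> range e"
    by (auto simp: bij_betw_def)
  let ?h = "ultratopology_of_point n e"
  have "homeomorphic_map beta (TYPE_space n) ?h"
  proof (rule continuous_imp_homeomorphic_map)
    show "continuous_map beta (TYPE_space n) ?h"
      unfolding TYPE_space_eq
      by (intro continuous_map_into_subtopology continuous_ultratopology_of_point)
         (use ultratopology_of_point_in_TYPE_set e(3) in auto)
    show "compact_space (beta :: ((nat \<Rightarrow> real) \<Rightarrow> real) topology)"
      by (rule compact_stone_cech)
    show "Hausdorff_space (TYPE_space n)"
      unfolding TYPE_space_eq by (intro Hausdorff_space_subtopology Hausdorff_two_power)
    show "?h ` topspace beta = topspace (TYPE_space n)"
      using TYPE_set_subset_image[OF e(2)] ultratopology_of_point_in_TYPE_set e(3)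
      by (auto simp: TYPE_space_eq)
    show "inj_on ?h (topspace beta)"
      by (rule inj_on_ultratopology_of_point[OF e(1,3)])
  qed
  then show ?thesis
    using homeomorphic_map_imp_homeomorphic_space homeomorphic_space_sym by blast
qed

end
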